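(* For every positive integer $n$, each of the following holds: (i) $\mathbb{E}^n \not\to (\ell_3,\ell_3,\ell_8)$; (ii) $\mathbb{E}^n \not\to (\ell_3,\ell_4,\ell_7)$; (iii) $\mathbb{E}^n \not\to (\ell_3,\ell_5,\ell_5)$. That is, for instance in (i), there is a coloring of $\mathbb{E}^n$ with three colors (say colors 1, 2, 3) with no congruent copy of $\ell_3$ in color 1, no congruent copy of $\ell_3$ in color 2, and no congruent copy of $\ell_8$ in color 3; similarly for (ii) and (iii).
   Context: $\mathbb{E}^n$ denotes $\mathbb{R}^n$ with the Euclidean norm. For an integer $m\ge 2$, $\ell_m$ denotes $m$ collinear points with consecutive points at distance $1$; a congruent copy of $\ell_m$ is a set $\{x_0,x_0+u,\dots,x_0+(m-1)u\}$ with $x_0\in\mathbb{E}^n$, $|u|=1$. For configurations $K_1,\dots,K_r$, $\mathbb{E}^n\not\to(K_1,\dots,K_r)$ means there is a coloring of $\mathbb{E}^n$ with colors $1,\dots,r$ such that for no $i$ is there a congruent copy of $K_i$ all of whose points have color $i$. *)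

theory Defs
  imports "HOL-Analysis.Analysis"
begin

text \<open>
  A configuration enters the relation only through its congruent copies in the ambient space,
  so a configuration is represented here by the family of all of them.
\<close>

definition ell :: "nat \<Rightarrow> 'a::euclidean_space set set" where
  "ell m = {{x + real i *\<^sub>R u | i. i < m} | x u. norm u = 1}"

text \<open>
  The \<open>r = length Ks\<close> colors are \<open>1, \<dots>, r\<close>; list positions start at \<open>0\<close>,
  so \<open>Ks ! (i - 1)\<close> belongs to color \<open>i\<close>.
\<close>

definition not_arrow :: "'a::euclidean_space set set list \<Rightarrow> bool" where
  "not_arrow Ks \<longleftrightarrow>
    (\<exists>c :: 'a \<Rightarrow> nat. (\<forall>x. c x \<in> {1..length Ks}) \<and>
      (\<forall>i \<in> {1..length Ks}. \<not> (\<exists>S \<in> Ks ! (i - 1). \<forall>p \<in> S. c p = i)))"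

end

theory Submission
  imports Defs
begin

text \<open>
  Color \<open>x\<close> by the residue of \<open>\<lfloor>k |x|\<^sup>2\<rfloor>\<close> modulo \<open>N\<close>. Along \<open>x, x + u, x + 2u, \<dots>\<close> with \<open>|u| = 1\<close>, the
  increments of \<open>k |x + i u|\<^sup>2\<close> form an arithmetic progression \<open>b + 2 k i\<close>, so those of its floor
  are \<open>\<lfloor>b\<rfloor> + 2 k i + e\<close> with \<open>e \<in> {0, 1}\<close>. Modulo \<open>N\<close> this leaves finitely many sequences of
  residues, and for suitable colorings of the residues (found by a SAT solver) none of them
  contains a forbidden monochromatic run.
\<close>

text \<open>\<open>v\<close> is the current residue and \<open>d\<close> that of the floored
  increment. The carry is chosen afresh at each step, which may admit more sequences than actual
  lines produce but keeps the search finite.\<close>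

fun mono_run :: "int \<Rightarrow> nat list \<Rightarrow> nat \<Rightarrow> nat \<Rightarrow> int \<Rightarrow> int \<Rightarrow> bool" where
  "mono_run k cs j 0 v d \<longleftrightarrow> True"
| "mono_run k cs j (Suc m) v d \<longleftrightarrow> cs ! nat v = j \<and>
     (mono_run k cs j m ((v + d) mod int (length cs)) ((d + 2 * k) mod int (length cs)) \<or>
      mono_run k cs j m ((v + d + 1) mod int (length cs)) ((d + 2 * k) mod int (length cs)))"

definition residue_color :: "nat list \<Rightarrow> real \<Rightarrow> nat" where
  "residue_color cs t = cs ! nat (\<lfloor>t\<rfloor> mod int (length cs))"

lemma floor_add_cases:
  fixes s t :: real
  shows "\<lfloor>s + t\<rfloor> = \<lfloor>s\<rfloor> + \<lfloor>t\<rfloor> \<or> \<lfloor>s + t\<rfloor> = \<lfloor>s\<rfloor> + \<lfloor>t\<rfloor> + 1"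
  by linarith

text \<open>Dropping the first point leaves the same recurrence with \<open>b + 2 * k\<close> in
  place of \<open>b\<close>. As \<open>2 * k\<close> is an integer, the floor of \<open>b\<close>
  shifts exactly, so the only uncertainty is the carry in the floor of
  \<open>y 0 + b\<close>.\<close>

lemma mono_run_floor:
  assumes "\<And>i. y (Suc i) = y i + b + of_int (2 * k) * real i"
    and "\<And>i. i < m \<Longrightarrow> residue_color cs (y i) = j"
  shows "mono_run k cs j m (\<lfloor>y 0\<rfloor> mod int (length cs)) (\<lfloor>b\<rfloor> mod int (length cs))"
  using assms
proof (induction m arbitrary: y b)
  case 0
  then show ?case by simp
next
  case (Suc m)
  have "mono_run k cs j m (\<lfloor>y (Suc 0)\<rfloor> mod int (length cs))
          (\<lfloor>b + of_int (2 * k)\<rfloor> mod int (length cs))"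
  proof (rule Suc.IH[of "\<lambda>i. y (Suc i)"])
    show "y (Suc (Suc i)) = y (Suc i) + (b + of_int (2 * k)) + of_int (2 * k) * real i" for i
      by (simp add: Suc.prems(1)[of "Suc i"] algebra_simps)
    show "residue_color cs (y (Suc i)) = j" if "i < m" for i
      using Suc.prems(2) that by blast
  qed
  moreover have "\<lfloor>b + of_int (2 * k)\<rfloor> = \<lfloor>b\<rfloor> + 2 * k"
    by (rule floor_add_int[symmetric])
  moreover have "y (Suc 0) = y 0 + b"
    using Suc.prems(1)[of 0] by simp
  moreover have "cs ! nat (\<lfloor>y 0\<rfloor> mod int (length cs)) = j"
    using Suc.prems(2)[of 0] by (simp add: residue_color_def)
  moreover have "(v mod n + d mod n + 1) mod n = (v + d + 1) mod n" for v d n :: int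
    by (metis mod_add_eq mod_add_left_eq)
  ultimately show ?case
    using floor_add_cases[of "y 0" b] by (auto simp: mod_simps)
qed

text \<open>Quantifying over explicit lists makes the check executable. \<open>Suc j\<close> is the
  color at list position \<open>j\<close>.\<close>

definition good_coloring :: "int \<Rightarrow> nat list \<Rightarrow> nat list \<Rightarrow> bool" where
  "good_coloring k cs ms \<longleftrightarrow> cs \<noteq> [] \<and> list_all (\<lambda>c. 1 \<le> c \<and> c \<le> length ms) cs \<and>
     list_all (\<lambda>j. list_all (\<lambda>v. list_all (\<lambda>d. \<not> mono_run k cs (Suc j) (ms ! j) v d)
       [0..int (length cs) - 1]) [0..int (length cs) - 1]) [0..<length ms]"

text \<open>The coloring depends on the norm alone, and the direction \<open>u\<close> enters only
  through \<open>x \<bullet> u\<close> and \<open>u \<bullet> u = 1\<close>, so one residue coloring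
  serves every dimension.\<close>

lemma not_arrow_if_good_coloring:
  assumes "good_coloring k cs ms"
  shows "not_arrow (map ell ms :: 'a::euclidean_space set set list)"
proof -
  define c where "c x = residue_color cs (of_int k * (norm x)\<^sup>2)" for x :: 'a
  have N: "0 < length cs"
    using assms by (simp add: good_coloring_def)
  have "c x \<in> {1..length ms}" for x
  proof -
    have "nat (\<lfloor>of_int k * (norm x)\<^sup>2\<rfloor> mod int (length cs)) < length cs"
      using N by (simp add: nat_less_iff)
    then show ?thesis
      using assms by (auto simp: good_coloring_def list_all_length c_def residue_color_def)
  qed
  moreover have False
    if i: "i \<in> {1..length ms}" and S: "S \<in> ell (ms ! (i - 1))" and mono: "\<forall>p\<in>S. c p = i"
    for i and S :: "'a set"
  proof -
    obtain x u where u: "norm u = 1"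
      and S_eq: "S = {x + real l *\<^sub>R u | l. l < ms ! (i - 1)}"
      using S by (auto simp: ell_def)
    define y where "y l = of_int k * (norm (x + real l *\<^sub>R u))\<^sup>2" for l
    \<comment> \<open>The first increment, \<open>k\<close> times the difference of the squared
      norms of \<open>x + u\<close> and \<open>x\<close>.\<close>
    define b where "b = of_int k * (2 * (x \<bullet> u) + 1)"
    have uu: "u \<bullet> u = 1"
      using u by (simp add: dot_square_norm)
    have "y (Suc l) = y l + b + of_int (2 * k) * real l" for l
      unfolding y_def b_def power2_norm_eq_inner
      by (simp add: inner_simps uu inner_commute[of u x] algebra_simps)
    moreover have "residue_color cs (y l) = i" if "l < ms ! (i - 1)" for l
      using mono S_eq that by (auto simp: c_def y_def)
    ultimately have "mono_run k cs i (ms ! (i - 1))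
        (\<lfloor>y 0\<rfloor> mod int (length cs)) (\<lfloor>b\<rfloor> mod int (length cs))"
      by (rule mono_run_floor)
    moreover have "z mod int (length cs) \<in> set [0..int (length cs) - 1]" for z
      using N by simp
    moreover have "i - 1 < length ms" "Suc (i - 1) = i"
      using i by auto
    ultimately show False
      using assms unfolding good_coloring_def list_all_iff by (metis atLeast_upt lessThan_iff)
  qed
  ultimately show ?thesis
    unfolding not_arrow_def by (intro exI[of _ c]) fastforce
qed

text \<open>Here the squared norm is cut into steps of 1/2 with period 5; the next two colorings use
  steps of 1 with period 8.\<close>

lemma good_coloring_3_3_8: "good_coloring 2 [3,3,3,2,2,3,3,3,1,1] [3,3,8]"
  by code_simp

lemma good_coloring_3_4_7: "good_coloring 1 [3,1,3,3,3,1,2,2] [3,4,7]"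
  by code_simp

lemma good_coloring_3_5_5: "good_coloring 1 [3,3,3,1,2,2,2,1] [3,5,5]"
  by code_simp

theorem theorem1p2:
  shows "not_arrow ([ell 3, ell 3, ell 8] :: (real ^ 'n) set set list)
       \<and> not_arrow ([ell 3, ell 4, ell 7] :: (real ^ 'n) set set list)
       \<and> not_arrow ([ell 3, ell 5, ell 5] :: (real ^ 'n) set set list)"
  using not_arrow_if_good_coloring[OF good_coloring_3_3_8, where ?'a = "real ^ 'n"]
    not_arrow_if_good_coloring[OF good_coloring_3_4_7, where ?'a = "real ^ 'n"]
    not_arrow_if_good_coloring[OF good_coloring_3_5_5, where ?'a = "real ^ 'n"]
  by simp

end
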